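(* (i) Let $L$ be a model, and for $x\in L$, $\alpha<\kappa$ let $x|_\alpha$ be the unique element with $x|_\alpha=_\alpha x$ and such that $x\sqsubseteq_\alpha y$ implies $x|_\alpha\leq y$ for all $y\in L$ (condition C). Then the maps $|_\alpha:L\to L$ satisfy: (B1) $(x|_\alpha)|_\beta=x|_\beta$ for all $x$ and $\beta\leq\alpha<\kappa$; (B2) $x\leq y$ implies $x|_\alpha\leq y|_\alpha$; (B3) $x=\bigvee_{\alpha<\kappa}x|_\alpha$ for all $x$; (B4) for all $\alpha<\kappa$, $y\in L$ and nonempty families $(x_i)_{i\in I}$ with $x_i|_\alpha=y$ for all $i$, $(\bigvee_i x_i)|_\alpha=y$; and moreover (D): for all $\alpha<\kappa$ and $x,y\in L$, $x\sqsubseteq_\alpha y$ iff $x|_\alpha\leq y|_\alpha$ and $x|_\beta=y|_\beta$ for all $\beta<\alpha$. (ii) Conversely, let $(L,\leq)$ be a complete lattice with functions $|_\alpha:L\to L$, $\alpha<\kappa$, satisfying B1–B4, and define relations $\sqsubseteq_\alpha$ by condition D. Then $(L,\leq,(\sqsubseteq_\alpha)_{\alpha<\kappa})$ is a model, and condition C holds (i.e., for each $x,\alpha$, the given $x|_\alpha$ satisfies $x|_\alpha=_\alpha x$ and $x\sqsubseteq_\alpha y\Rightarrow x|_\alpha\leq y$).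
   Context: Fix a limit ordinal $\kappa$. A stratified complete lattice is $(L,\leq,(\sqsubseteq_\alpha)_{\alpha<\kappa})$ with $(L,\leq)$ a complete lattice and each $\sqsubseteq_\alpha$ a preorder; $x=_\alpha y$ means $x\sqsubseteq_\alpha y$ and $y\sqsubseteq_\alpha x$. A model satisfies: (A1) for $\alpha<\beta<\kappa$, $x\sqsubseteq_\beta y$ implies $x=_\alpha y$; (A2) if $x=_\alpha y$ for all $\alpha$ then $x=y$; (A3) for all $x,\alpha$ there is $y$ with $x=_\alpha y$ such that for all $z$, $x\sqsubseteq_\alpha z$ implies $y\leq z$ (such $y$ is unique); (A4) for nonempty $I$ and $x_i=_\alpha y$ ($i\in I$), $\bigvee_i x_i=_\alpha y$; (A5) $x\leq y$ implies $x|_\alpha\leq y|_\alpha$, where $x|_\alpha$ is the element given by A3; (A6) if $x\leq y$ and $x=_\beta y$ for all $\beta<\alpha$ then $x\sqsubseteq_\alpha y$. *)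

theory Defs
  imports Main
begin

text \<open>
  The ordinals below a nonzero limit ordinal are the elements of a type \<open>'k\<close> of class
  \<open>wellorder\<close> without a greatest element (class \<open>no_top\<close>); the order types of such types
  are nonzero limit ordinals. The complete lattice is a type \<open>'a\<close> of class
  \<open>complete_lattice\<close>. In what follows, \<open>sq \<alpha>\<close> is the relation with index \<open>\<alpha>\<close> and
  \<open>r \<alpha> x\<close> is the restriction of \<open>x\<close> to \<open>\<alpha>\<close>.
\<close>

definition eq_at :: "('k \<Rightarrow> 'a \<Rightarrow> 'a \<Rightarrow> bool) \<Rightarrow> 'k \<Rightarrow> 'a \<Rightarrow> 'a \<Rightarrow> bool" where
  "eq_at sq \<alpha> x y \<longleftrightarrow> sq \<alpha> x y \<and> sq \<alpha> y x"

definition is_restr :: "('k \<Rightarrow> 'a \<Rightarrow> 'a \<Rightarrow> bool) \<Rightarrow> 'k \<Rightarrow> 'a::complete_lattice \<Rightarrow> 'a \<Rightarrow> bool" where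
  "is_restr sq \<alpha> x y \<longleftrightarrow> eq_at sq \<alpha> x y \<and> (\<forall>z. sq \<alpha> x z \<longrightarrow> y \<le> z)"

definition restr :: "('k \<Rightarrow> 'a \<Rightarrow> 'a \<Rightarrow> bool) \<Rightarrow> 'k \<Rightarrow> 'a::complete_lattice \<Rightarrow> 'a" where
  "restr sq \<alpha> x = (THE y. is_restr sq \<alpha> x y)"

locale stratified_complete_lattice =
  fixes sq :: "'k::{wellorder,no_top} \<Rightarrow> 'a::complete_lattice \<Rightarrow> 'a \<Rightarrow> bool"
  assumes sq_refl: "reflp (sq \<alpha>)"
    and sq_trans: "transp (sq \<alpha>)"

text \<open>
  A supremum depends only on the set of members of a family, so nonempty families in
  \<open>A4\<close> and \<open>B4\<close> are given as nonempty sets. In \<open>A5\<close>, the description operator in \<open>restr\<close>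
  is well defined: \<open>A3\<close> gives existence, and antisymmetry of the order gives uniqueness.
\<close>

locale stratified_model = stratified_complete_lattice sq
  for sq :: "'k::{wellorder,no_top} \<Rightarrow> 'a::complete_lattice \<Rightarrow> 'a \<Rightarrow> bool" +
  assumes A1: "\<alpha> < \<beta> \<Longrightarrow> sq \<beta> x y \<Longrightarrow> eq_at sq \<alpha> x y"
    and A2: "(\<And>\<alpha>. eq_at sq \<alpha> x y) \<Longrightarrow> x = y"
    and A3: "\<exists>y. is_restr sq \<alpha> x y"
    and A4: "X \<noteq> {} \<Longrightarrow> (\<And>x. x \<in> X \<Longrightarrow> eq_at sq \<alpha> x y) \<Longrightarrow> eq_at sq \<alpha> (Sup X) y"
    and A5: "x \<le> y \<Longrightarrow> restr sq \<alpha> x \<le> restr sq \<alpha> y"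
    and A6: "x \<le> y \<Longrightarrow> (\<And>\<beta>. \<beta> < \<alpha> \<Longrightarrow> eq_at sq \<beta> x y) \<Longrightarrow> sq \<alpha> x y"

locale restriction_maps =
  fixes r :: "'k::{wellorder,no_top} \<Rightarrow> 'a::complete_lattice \<Rightarrow> 'a"
  assumes B1: "\<beta> \<le> \<alpha> \<Longrightarrow> r \<beta> (r \<alpha> x) = r \<beta> x"
    and B2: "x \<le> y \<Longrightarrow> r \<alpha> x \<le> r \<alpha> y"
    and B3: "x = (SUP \<alpha>. r \<alpha> x)"
    and B4: "X \<noteq> {} \<Longrightarrow> (\<And>x. x \<in> X \<Longrightarrow> r \<alpha> x = y) \<Longrightarrow> r \<alpha> (Sup X) = y"

definition cond_C ::
  "('k::{wellorder,no_top} \<Rightarrow> 'a::complete_lattice \<Rightarrow> 'a \<Rightarrow> bool) \<Rightarrow> ('k \<Rightarrow> 'a \<Rightarrow> 'a) \<Rightarrow> bool" where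
  "cond_C sq r \<longleftrightarrow>
    (\<forall>\<alpha> x. eq_at sq \<alpha> (r \<alpha> x) x \<and> (\<forall>y. sq \<alpha> x y \<longrightarrow> r \<alpha> x \<le> y))"

definition cond_D ::
  "('k::{wellorder,no_top} \<Rightarrow> 'a::complete_lattice \<Rightarrow> 'a \<Rightarrow> bool) \<Rightarrow> ('k \<Rightarrow> 'a \<Rightarrow> 'a) \<Rightarrow> bool" where
  "cond_D sq r \<longleftrightarrow>
    (\<forall>\<alpha> x y. sq \<alpha> x y \<longleftrightarrow> r \<alpha> x \<le> r \<alpha> y \<and> (\<forall>\<beta><\<alpha>. r \<beta> x = r \<beta> y))"

end

theory Submission
  imports Defs
begin

text \<open>
  In both directions the key is that \<open>=\<^sub>\<alpha>\<close> is the kernel of \<open>x \<mapsto> x|\<^sub>\<alpha>\<close>: this turns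
  \<open>A1\<close>, \<open>A2\<close> and \<open>A4\<close> into \<open>B1\<close>, \<open>B3\<close> and \<open>B4\<close>, and \<open>A6\<close>, applied to the restrictions,
  into the right-to-left half of \<open>D\<close>.
\<close>

text \<open>Each candidate lies \<open>sq \<alpha>\<close>-above \<open>x\<close>, so the minimality
  of the other one applies to it; both inequalities together give equality.\<close>

lemma is_restr_unique:
  fixes y z :: "'a::complete_lattice"
  assumes "is_restr sq \<alpha> x y" and "is_restr sq \<alpha> x z"
  shows "y = z"
  using assms unfolding is_restr_def eq_at_def by (meson order_antisym)

lemma restr_eqI:
  assumes "is_restr sq \<alpha> x y"
  shows "restr sq \<alpha> x = y"
  unfolding restr_def using assms is_restr_unique by (metis the_equality)

context stratified_model
begin

lemma is_restr_restr: "is_restr sq \<alpha> x (restr sq \<alpha> x)"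
  using A3 restr_eqI by metis

lemma ex1_is_restr: "\<exists>!y. is_restr sq \<alpha> x y"
  using is_restr_restr by (rule ex1I) (rule is_restr_unique[OF _ is_restr_restr])

lemma sq_restr: "sq \<alpha> x (restr sq \<alpha> x)" "sq \<alpha> (restr sq \<alpha> x) x"
  using is_restr_restr[of \<alpha> x] unfolding is_restr_def eq_at_def by auto

lemma restr_le: "sq \<alpha> x y \<Longrightarrow> restr sq \<alpha> x \<le> y"
  using is_restr_restr[of \<alpha> x] unfolding is_restr_def by auto

lemma sq_transD: "sq \<alpha> x y \<Longrightarrow> sq \<alpha> y z \<Longrightarrow> sq \<alpha> x z"
  using sq_trans by (rule transpD)

text \<open>By transitivity \<open>restr sq \<alpha> y\<close> is itself
  \<open>sq \<alpha>\<close>-above \<open>x\<close>, so the minimality of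
  \<open>restr sq \<alpha> x\<close> applies to it.\<close>

lemma restr_mono_sq: "sq \<alpha> x y \<Longrightarrow> restr sq \<alpha> x \<le> restr sq \<alpha> y"
  by (meson restr_le sq_restr(1) sq_transD)

lemma restr_le_self: "restr sq \<alpha> x \<le> x"
  using restr_le sq_refl by (metis reflpD)

lemma eq_at_iff: "eq_at sq \<alpha> x y \<longleftrightarrow> restr sq \<alpha> x = restr sq \<alpha> y"
proof
  assume "eq_at sq \<alpha> x y"
  then show "restr sq \<alpha> x = restr sq \<alpha> y"
    unfolding eq_at_def by (simp add: order_antisym restr_mono_sq)
next
  assume "restr sq \<alpha> x = restr sq \<alpha> y"
  then show "eq_at sq \<alpha> x y"
    unfolding eq_at_def by (metis sq_restr sq_transD)
qed

text \<open>For \<beta> < \<alpha>, A1 lowers the equivalence of \<open>x\<close> with its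
  restriction from \<alpha> to \<beta>, and the kernel description concludes. The case \<beta> =
  \<alpha> is idempotence.\<close>

lemma restr_restr:
  assumes "\<beta> \<le> \<alpha>"
  shows "restr sq \<beta> (restr sq \<alpha> x) = restr sq \<beta> x"
proof (cases "\<beta> = \<alpha>")
  case True
  then show ?thesis
    using eq_at_iff sq_restr unfolding eq_at_def by metis
next
  case False
  with assms have "\<beta> < \<alpha>" by simp
  then show ?thesis using A1 sq_restr(2) eq_at_iff by blast
qed

lemma eq_SUP_restr: "x = (SUP \<alpha>. restr sq \<alpha> x)"
proof (rule A2)
  fix \<alpha>
  let ?s = "SUP \<alpha>. restr sq \<alpha> x"
  have "?s \<le> x" by (intro SUP_least restr_le_self)
  then have "restr sq \<alpha> ?s \<le> restr sq \<alpha> x" by (rule A5)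
  \<comment> \<open>The restriction at \<alpha> is one of the joined elements. By idempotence this
    lower bound equals the upper bound just found, which squeezes
    \<open>restr sq \<alpha> ?s\<close>.\<close>
  moreover have "restr sq \<alpha> (restr sq \<alpha> x) \<le> restr sq \<alpha> ?s"
    by (intro A5 SUP_upper) simp
  ultimately show "eq_at sq \<alpha> x ?s"
    by (simp add: eq_at_iff restr_restr order_antisym)
qed

lemma restr_Sup:
  assumes "X \<noteq> {}" and eq: "\<And>x. x \<in> X \<Longrightarrow> restr sq \<alpha> x = y"
  shows "restr sq \<alpha> (Sup X) = y"
proof -
  \<comment> \<open>Since \<open>X\<close> is nonempty, \<open>y\<close> is a value of the
    restriction map and hence a fixed point, so the members of \<open>X\<close> are equivalent to
    \<open>y\<close> itself, as A4 demands.\<close>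
  have y: "restr sq \<alpha> y = y"
    using assms restr_restr by (metis ex_in_conv order_refl)
  have "eq_at sq \<alpha> (Sup X) y"
    using assms y by (intro A4) (auto simp: eq_at_iff)
  then show ?thesis using y by (simp add: eq_at_iff)
qed

lemma restriction_maps_restr: "restriction_maps (restr sq)"
  by unfold_locales (fact restr_restr A5 eq_SUP_restr restr_Sup)+

lemma cond_C_restr: "cond_C sq (restr sq)"
  unfolding cond_C_def eq_at_def using sq_restr restr_le by blast

lemma cond_D_restr: "cond_D sq (restr sq)"
  unfolding cond_D_def
proof (intro allI iffI conjI impI)
  fix \<alpha> \<beta> x y
  assume "sq \<alpha> x y"
  then show "restr sq \<alpha> x \<le> restr sq \<alpha> y" by (rule restr_mono_sq)
  assume "\<beta> < \<alpha>"
  then show "restr sq \<beta> x = restr sq \<beta> y" using \<open>sq \<alpha> x y\<close> A1 eq_at_iff by blast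
next
  fix \<alpha> x y
  assume *: "restr sq \<alpha> x \<le> restr sq \<alpha> y \<and> (\<forall>\<beta><\<alpha>. restr sq \<beta> x = restr sq \<beta> y)"
  \<comment> \<open>A6 requires comparable elements, and \<open>x\<close> and \<open>y\<close> may
    be incomparable. Their restrictions are comparable and agree with them at every index below
    \<alpha>; transitivity then carries the relation back.\<close>
  then have "sq \<alpha> (restr sq \<alpha> x) (restr sq \<alpha> y)"
    by (intro A6) (auto simp: eq_at_iff restr_restr)
  then show "sq \<alpha> x y" using sq_restr sq_transD by blast
qed

end

context restriction_maps
begin

lemma r_le: "r \<alpha> x \<le> x"
proof -
  have "r \<alpha> x \<le> (SUP \<alpha>. r \<alpha> x)" by (rule SUP_upper) simp
  then show ?thesis using B3[of x] by simp
qed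

lemma cond_D_eq_at_iff:
  assumes "cond_D sq r"
  shows "eq_at sq \<alpha> x y \<longleftrightarrow> r \<alpha> x = r \<alpha> y"
proof
  assume "r \<alpha> x = r \<alpha> y"
  \<comment> \<open>Equality at \<alpha> descends to all smaller indices by B1, which supplies the
    second clause of D.\<close>
  moreover from this have "r \<beta> x = r \<beta> y" if "\<beta> < \<alpha>" for \<beta>
    using B1[of \<beta> \<alpha>] that by (metis less_imp_le)
  ultimately show "eq_at sq \<alpha> x y"
    using assms unfolding eq_at_def cond_D_def by simp
next
  assume "eq_at sq \<alpha> x y"
  then show "r \<alpha> x = r \<alpha> y"
    using assms unfolding eq_at_def cond_D_def by (meson order_antisym)
qed

lemma cond_D_is_restr:
  assumes "cond_D sq r"
  shows "is_restr sq \<alpha> x (r \<alpha> x)"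
  unfolding is_restr_def
proof (intro conjI allI impI)
  show "eq_at sq \<alpha> x (r \<alpha> x)" by (simp add: cond_D_eq_at_iff[OF assms] B1)
next
  fix z
  assume "sq \<alpha> x z"
  then have "r \<alpha> x \<le> r \<alpha> z" using assms unfolding cond_D_def by blast
  then show "r \<alpha> x \<le> z" using r_le order_trans by blast
qed

lemma cond_D_cond_C:
  assumes "cond_D sq r"
  shows "cond_C sq r"
  using cond_D_is_restr[OF assms] unfolding cond_C_def is_restr_def eq_at_def by blast

lemma cond_D_stratified_model:
  assumes D: "cond_D sq r"
  shows "stratified_model sq"
proof
  note D' = D[unfolded cond_D_def, rule_format]
  note eq = cond_D_eq_at_iff[OF D]
  \<comment> \<open>Identifies the restriction described through \<open>sq\<close> with the given
    map, so that A5 becomes B2.\<close>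
  have restr: "restr sq \<alpha> x = r \<alpha> x" for \<alpha> x
    using cond_D_is_restr[OF D] by (rule restr_eqI)
  show "reflp (sq \<alpha>)" for \<alpha>
    by (rule reflpI) (simp add: D')
  show "transp (sq \<alpha>)" for \<alpha>
    by (rule transpI) (auto simp: D' intro: order_trans)
  show "eq_at sq \<alpha> x y" if "\<alpha> < \<beta>" "sq \<beta> x y" for \<alpha> \<beta> x y
    using that by (simp add: eq D')
  show "x = y" if "\<And>\<alpha>. eq_at sq \<alpha> x y" for x y
    \<comment> \<open>Both elements are joins of the same family of restrictions.\<close>
    using that B3[of x] B3[of y] by (simp add: eq)
  show "\<exists>y. is_restr sq \<alpha> x y" for \<alpha> x
    using cond_D_is_restr[OF D] by blast
  show "eq_at sq \<alpha> (Sup X) y" if "X \<noteq> {}" "\<And>x. x \<in> X \<Longrightarrow> eq_at sq \<alpha> x y" for \<alpha> X y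
    using that by (simp add: eq B4)
  show "restr sq \<alpha> x \<le> restr sq \<alpha> y" if "x \<le> y" for \<alpha> x y
    using that by (simp add: restr B2)
  show "sq \<alpha> x y" if "x \<le> y" "\<And>\<beta>. \<beta> < \<alpha> \<Longrightarrow> eq_at sq \<beta> x y" for \<alpha> x y
    using that by (simp add: D' B2 eq)
qed

end

text \<open>In the converse half, \<open>cond_D sq r\<close> fixes every value of \<open>sq\<close>
  in terms of \<open>r\<close>, so quantifying over such \<open>sq\<close> amounts to defining the
  relations by D.\<close>

theorem theorem1:
  shows "(\<forall>sq :: 'k::{wellorder,no_top} \<Rightarrow> 'a::complete_lattice \<Rightarrow> 'a \<Rightarrow> bool.
            stratified_model sq \<longrightarrow>
              (\<forall>\<alpha> x. \<exists>!y. is_restr sq \<alpha> x y) \<and> cond_C sq (restr sq) \<and>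
              restriction_maps (restr sq) \<and> cond_D sq (restr sq))
       \<and> (\<forall>(r :: 'k \<Rightarrow> 'a \<Rightarrow> 'a) sq.
            restriction_maps r \<and> cond_D sq r \<longrightarrow>
              stratified_model sq \<and> cond_C sq r)"
proof (intro conjI allI impI)
  fix sq :: "'k \<Rightarrow> 'a \<Rightarrow> 'a \<Rightarrow> bool" and \<alpha> x
  assume "stratified_model sq"
  then interpret stratified_model sq .
  show "\<exists>!y. is_restr sq \<alpha> x y" by (rule ex1_is_restr)
  show "cond_C sq (restr sq)" by (rule cond_C_restr)
  show "restriction_maps (restr sq)" by (rule restriction_maps_restr)
  show "cond_D sq (restr sq)" by (rule cond_D_restr)
next
  fix r :: "'k \<Rightarrow> 'a \<Rightarrow> 'a" and sq
  assume *: "restriction_maps r \<and> cond_D sq r"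
  then interpret restriction_maps r by blast
  show "stratified_model sq" using * cond_D_stratified_model by blast
  show "cond_C sq r" using * cond_D_cond_C by blast
qed

end
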